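(* Let $n>2$ be an integer, $N=n(n-1)/2$ and $N'=(n-1)(n-2)/2$. Then the $n-2$ highest-degree terms of the flow polynomial $F_{K_n}(x)$ of the complete graph $K_n$ are $$x^{N'}-N x^{N'-1}+\binom{N}{2}x^{N'-2}-\ldots+(-1)^{n-3}\binom{N}{n-3}x^{N'-n+3}.$$ That is, $F_{K_n}$ has degree $N'$, and for every integer $k$ with $0\le k\le n-3$ the coefficient of $x^{N'-k}$ in $F_{K_n}(x)$ equals $(-1)^k\binom{N}{k}$.
   Context: The flow polynomial $F_G$ of a graph $G=(V,E)$ is the polynomial such that, for every positive integer $q$, $F_G(q)$ is the number of nowhere-zero flows with values in $\mathbb{Z}_q=\mathbb{Z}/q\mathbb{Z}$: after fixing any orientation of the edges, these are the assignments of a nonzero element $k_e\in\mathbb{Z}_q$ to each edge $e$ such that at every vertex the sum of $k_e$ over incoming edges equals the sum over outgoing edges. Equivalently, $F_G$ is the characteristic polynomial $\chi_{M}(x)=\sum_{A\subseteq E}(-1)^{|A|}x^{r_M(E)-r_M(A)}$ of the dual $M=M_G^*$ of the graphic matroid $M_G$ of $G$. *)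

theory Defs
  imports
    "Graph_Theory.Digraph"
    "HOL-Library.FuncSet"
    "HOL-Number_Theory.Cong"
    "HOL-Computational_Algebra.Polynomial"
begin

text \<open>
  Undirected graphs; parallel edges are allowed, and an edge \<open>e\<close> with \<open>ends G e = {v}\<close> is a loop.
\<close>

record ('v, 'e) ugraph =
  vertices :: "'v set"
  edges :: "'e set"
  ends :: "'e \<Rightarrow> 'v set"

definition complete_ugraph :: "'v set \<Rightarrow> ('v, 'v set) ugraph" where
  "complete_ugraph V = \<lparr>vertices = V, edges = {e. e \<subseteq> V \<and> card e = 2}, ends = (\<lambda>e. e)\<rparr>"

definition orientation_of :: "('v, 'e) pre_digraph \<Rightarrow> ('v, 'e) ugraph \<Rightarrow> bool" where
  "orientation_of D G \<longleftrightarrow>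
     verts D = vertices G \<and> arcs D = edges G \<and>
     (\<forall>e\<in>edges G. {tail D e, head D e} = ends G e)"

text \<open>
  The nonzero elements of \<open>\<int>/q\<int>\<close> are represented by \<open>1, \<dots>, q - 1\<close>. Flows are extensional, so that
  functions differing only outside the arc set are not counted separately.
\<close>

definition nowhere_zero_flows :: "('v, 'e) pre_digraph \<Rightarrow> nat \<Rightarrow> ('e \<Rightarrow> nat) set" where
  "nowhere_zero_flows D q =
     {k \<in> arcs D \<rightarrow>\<^sub>E {1..<q}.
        \<forall>v\<in>verts D. [(\<Sum>e\<in>in_arcs D v. k e) = (\<Sum>e\<in>out_arcs D v. k e)] (mod q)}"

text \<open>
  The number of flows does not depend on the orientation, hence the quantification over all of
  them. The definition is meaningful for finite graphs in which every edge has one or two ends,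
  all of them vertices.
\<close>

definition flow_polynomial :: "('v, 'e) ugraph \<Rightarrow> int poly" where
  "flow_polynomial G =
     (THE p. \<forall>D. orientation_of D G \<longrightarrow>
        (\<forall>q>0. poly p (int q) = int (card (nowhere_zero_flows D q))))"

end

theory Submission
  imports Defs
begin

text \<open>
  By inclusion-exclusion over the support, the flow polynomial is the alternating sum over edge
  sets \<open>A\<close> of \<open>x ^ r A\<close>, where \<open>q ^ r A\<close> counts the \<open>q\<close>-circulations supported in \<open>A\<close>. Adding an
  edge to \<open>A\<close> raises \<open>r A\<close> by one if its ends are already connected and leaves it unchanged
  otherwise. In \<open>K\<^sub>n\<close> a star has \<open>r = 0\<close>, and removing \<open>j \<le> n - 2\<close> edges one at a time lowers \<open>r\<close> by
  one each time, because some path of length two between the ends of the removed edge survives.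
  Removing more edges leaves \<open>r \<le> N' - (n - 2)\<close>, so that the top \<open>n - 2\<close> coefficients just count
  edge subsets.
\<close>

section \<open>Circulations\<close>

text \<open>Inflow minus outflow as one sum over all arcs: it is visibly linear in \<open>h\<close>,
  and a loop contributes zero. Integer values make subtraction genuine.\<close>

definition net_flow :: "('v, 'e) pre_digraph \<Rightarrow> ('e \<Rightarrow> int) \<Rightarrow> 'v \<Rightarrow> int" where
  "net_flow D h v = (\<Sum>e\<in>arcs D. h e * (of_bool (head D e = v) - of_bool (tail D e = v)))"

text \<open>Functions live on all arcs even when the support is confined to \<open>A\<close>, so the
  sets for different \<open>A\<close> are nested and can be compared directly.\<close>

definition circulations :: "('v, 'e) pre_digraph \<Rightarrow> 'e set \<Rightarrow> nat \<Rightarrow> ('e \<Rightarrow> nat) set" where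
  "circulations D A q =
     {k \<in> arcs D \<rightarrow>\<^sub>E {..<q}. (\<forall>e\<in>arcs D - A. k e = 0) \<and>
        (\<forall>v\<in>verts D. int q dvd net_flow D (\<lambda>e. int (k e)) v)}"

lemma net_flow_add: "net_flow D (\<lambda>e. g e + h e) v = net_flow D g v + net_flow D h v"
  by (simp add: net_flow_def distrib_right sum.distrib)

lemma net_flow_scale: "net_flow D (\<lambda>e. c * h e) v = c * net_flow D h v"
  by (simp add: net_flow_def sum_distrib_left mult.assoc)

lemma net_flow_single:
  assumes "finite (arcs D)" "e \<in> arcs D"
  shows "net_flow D (\<lambda>x. if x = e then c else 0) v
           = c * (of_bool (head D e = v) - of_bool (tail D e = v))"
proof -
  have "net_flow D (\<lambda>x. if x = e then c else 0) v
          = (\<Sum>x\<in>arcs D. if x = e then c * (of_bool (head D e = v) - of_bool (tail D e = v)) else 0)"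
    unfolding net_flow_def by (intro sum.cong) auto
  then show ?thesis using assms by simp
qed

lemma net_flow_cong_mod:
  assumes "\<And>e. e \<in> arcs D \<Longrightarrow> [g e = h e] (mod m)"
  shows "[net_flow D g v = net_flow D h v] (mod m)"
  unfolding net_flow_def using assms by (intro cong_sum cong_mult cong_refl) auto

lemma net_flow_in_out:
  assumes "finite (arcs D)"
  shows "net_flow D h v = (\<Sum>e\<in>in_arcs D v. h e) - (\<Sum>e\<in>out_arcs D v. h e)"
proof -
  have "(\<Sum>e\<in>arcs D. h e * of_bool (P e)) = sum h {e \<in> arcs D. P e}" for P
    unfolding sum.inter_filter[OF assms] by (intro sum.cong) auto
  then show ?thesis
    by (simp add: net_flow_def right_diff_distrib sum_subtractf in_arcs_def out_arcs_def)
qed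

text \<open>After exchanging the sums, an arc with both ends in \<open>C\<close> cancels; only arcs
  crossing the boundary of \<open>C\<close> survive.\<close>

lemma sum_net_flow:
  assumes "finite C"
  shows "(\<Sum>v\<in>C. net_flow D h v)
           = (\<Sum>e\<in>arcs D. h e * (of_bool (head D e \<in> C) - of_bool (tail D e \<in> C)))"
proof -
  have "(\<Sum>v\<in>C. net_flow D h v)
          = (\<Sum>e\<in>arcs D. \<Sum>v\<in>C. h e * (of_bool (head D e = v) - of_bool (tail D e = v)))"
    unfolding net_flow_def by (rule sum.swap)
  also have "\<dots> = (\<Sum>e\<in>arcs D. h e * (of_bool (head D e \<in> C) - of_bool (tail D e \<in> C)))"
    using assms by (simp add: sum_subtractf of_bool_def flip: sum_distrib_left)
  finally show ?thesis .
qed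

lemma finite_circulations: "finite (arcs D) \<Longrightarrow> finite (circulations D A q)"
  by (rule finite_subset[of _ "arcs D \<rightarrow>\<^sub>E {..<q}"]) (auto simp: circulations_def finite_PiE)

lemma circulations_mono: "A \<subseteq> B \<Longrightarrow> circulations D A q \<subseteq> circulations D B q"
  by (auto simp: circulations_def)

lemma circulations_empty:
  assumes "q > 0"
  shows "circulations D {} q = {\<lambda>e\<in>arcs D. 0}"
proof -
  have "net_flow D (\<lambda>e. int ((\<lambda>e\<in>arcs D. 0) e)) v = 0" for v
    by (simp add: net_flow_def)
  then show ?thesis
    using assms by (auto simp: circulations_def PiE_iff extensional_def restrict_def)
qed

lemma nowhere_zero_flows_eq:
  fixes D :: "('v, 'e) pre_digraph"
  assumes "finite (arcs D)"
  shows "nowhere_zero_flows D q = {k \<in> circulations D (arcs D) q. {e \<in> arcs D. k e \<noteq> 0} = arcs D}"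
proof -
  have "[(\<Sum>e\<in>in_arcs D v. k e) = (\<Sum>e\<in>out_arcs D v. k e)] (mod q)
          \<longleftrightarrow> int q dvd net_flow D (\<lambda>e. int (k e)) v" for k :: "'e \<Rightarrow> nat" and v
    unfolding net_flow_in_out[OF assms] cong_iff_dvd_diff[symmetric]
    by (simp flip: cong_int_iff)
  moreover have "k \<in> arcs D \<rightarrow>\<^sub>E {1..<q}
          \<longleftrightarrow> k \<in> arcs D \<rightarrow>\<^sub>E {..<q} \<and> {e \<in> arcs D. k e \<noteq> 0} = arcs D" for k :: "'e \<Rightarrow> nat"
    unfolding PiE_iff atLeastLessThan_iff lessThan_iff One_nat_def Suc_le_eq by blast
  ultimately show ?thesis
    by (auto simp: nowhere_zero_flows_def circulations_def)
qed

section \<open>The effect of one additional edge on the number of circulations\<close>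

definition shift :: "('v, 'e) pre_digraph \<Rightarrow> nat \<Rightarrow> ('e \<Rightarrow> int) \<Rightarrow> int \<Rightarrow> ('e \<Rightarrow> nat) \<Rightarrow> 'e \<Rightarrow> nat" where
  "shift D q h c k = (\<lambda>e\<in>arcs D. nat ((int (k e) + c * h e) mod int q))"

text \<open>Here \<open>h\<close> is an integral circulation supported in \<open>A\<close>. Adding a
  multiple of it preserves conservation, and reducing modulo \<open>q\<close> changes net flows only
  by multiples of \<open>q\<close>.\<close>

lemma shift_in_circulations:
  assumes "q > 0" "k \<in> circulations D A q"
    and "\<And>e. e \<in> arcs D - A \<Longrightarrow> h e = 0"
    and "\<And>v. v \<in> verts D \<Longrightarrow> net_flow D h v = 0"
  shows "shift D q h c k \<in> circulations D A q"
proof -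
  have "int q dvd net_flow D (\<lambda>e. int (shift D q h c k e)) v" if "v \<in> verts D" for v
  proof -
    have "[net_flow D (\<lambda>e. int (shift D q h c k e)) v
             = net_flow D (\<lambda>e. int (k e) + c * h e) v] (mod int q)"
      using assms(1) by (intro net_flow_cong_mod) (simp add: shift_def cong_def)
    also have "net_flow D (\<lambda>e. int (k e) + c * h e) v = net_flow D (\<lambda>e. int (k e)) v"
      using assms(4) that by (simp add: net_flow_add net_flow_scale)
    finally show ?thesis
      using assms(2) that by (simp add: circulations_def cong_dvd_iff)
  qed
  moreover have "shift D q h c k \<in> arcs D \<rightarrow>\<^sub>E {..<q}"
    using assms(1) by (auto simp: shift_def nat_less_iff)
  moreover have "\<forall>e\<in>arcs D - A. shift D q h c k e = 0"
    using assms(2,3) by (auto simp: shift_def circulations_def)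
  ultimately show ?thesis by (simp add: circulations_def)
qed

lemma shift_shift:
  assumes "q > 0"
  shows "shift D q h c (shift D q h d k) = shift D q h (c + d) k"
proof -
  have "((int (k e) + d * h e) mod int q + c * h e) mod int q = (int (k e) + (c + d) * h e) mod int q" for e
    unfolding mod_add_left_eq by (simp add: algebra_simps)
  then show ?thesis
    using assms by (simp add: shift_def fun_eq_iff)
qed

lemma shift_0:
  assumes "k \<in> circulations D A q"
  shows "shift D q h 0 k = k"
proof
  fix e
  show "shift D q h 0 k e = k e"
    using assms by (cases "e \<in> arcs D") (auto simp: shift_def circulations_def PiE_iff extensional_def)
qed

text \<open>A circulation on \<open>insert e A\<close> is uniquely a circulation on \<open>A\<close>
  plus \<open>c\<close> times \<open>h\<close> with \<open>c < q\<close>: since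
  \<open>h e = 1\<close>, the value at \<open>e\<close> determines \<open>c\<close>, and subtracting
  that multiple clears \<open>e\<close>.\<close>

lemma card_circulations_cycle:
  assumes "finite (arcs D)" "q > 0" "e \<in> arcs D - A"
    and "h e = 1" "\<And>x. x \<in> arcs D - insert e A \<Longrightarrow> h x = 0"
    and "\<And>v. v \<in> verts D \<Longrightarrow> net_flow D h v = 0"
  shows "card (circulations D (insert e A) q) = q * card (circulations D A q)"
proof -
  note in_circ = shift_in_circulations[OF assms(2) _ assms(5,6)]
  have k0: "k e = 0" if "k \<in> circulations D A q" for k
    using assms(3) that by (auto simp: circulations_def)
  have lt: "k e < q" if "k \<in> circulations D B q" for k B
    using assms(3) that by (auto simp: circulations_def)
  have at_e: "shift D q h c k e = nat ((int (k e) + c) mod int q)" for c k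
    using assms(3,4) by (simp add: shift_def)
  let ?f = "\<lambda>(c, k). shift D q h (int c) k"
  let ?g = "\<lambda>k. (k e, shift D q h (- int (k e)) k)"
  have "bij_betw ?f ({..<q} \<times> circulations D A q) (circulations D (insert e A) q)"
  proof (rule bij_betw_byWitness[where f' = ?g])
    show "\<forall>p\<in>{..<q} \<times> circulations D A q. ?g (?f p) = p"
      using assms(2) by (auto simp: at_e k0 shift_shift shift_0)
    show "\<forall>k\<in>circulations D (insert e A) q. ?f (?g k) = k"
      using assms(2) by (auto simp: shift_shift shift_0)
    show "?f ` ({..<q} \<times> circulations D A q) \<subseteq> circulations D (insert e A) q"
      using circulations_mono[of A "insert e A" D q] by (auto intro!: in_circ)
    have "shift D q h (- int (k e)) k \<in> circulations D A q"
      if "k \<in> circulations D (insert e A) q" for k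
      using in_circ[OF that, of "- int (k e)"] at_e[of "- int (k e)" k]
      by (auto simp: circulations_def)
    then show "?g ` circulations D (insert e A) q \<subseteq> {..<q} \<times> circulations D A q"
      using lt by auto
  qed
  from bij_betw_same_card[OF this, symmetric] show ?thesis
    by (simp add: card_cartesian_product)
qed

text \<open>Summing conservation over \<open>C\<close> leaves only the value on \<open>e\<close>,
  the one possible crossing edge in the support. It is divisible by \<open>q\<close> and smaller
  than \<open>q\<close>, hence zero.\<close>

lemma circulations_cut:
  assumes "finite (arcs D)" "e \<in> arcs D" "finite C" "C \<subseteq> verts D"
    and "(head D e \<in> C) \<noteq> (tail D e \<in> C)"
    and "\<And>x. x \<in> A \<Longrightarrow> x \<in> arcs D \<Longrightarrow> (head D x \<in> C) = (tail D x \<in> C)"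
  shows "circulations D (insert e A) q = circulations D A q"
proof
  show "circulations D A q \<subseteq> circulations D (insert e A) q"
    by (rule circulations_mono) auto
  show "circulations D (insert e A) q \<subseteq> circulations D A q"
  proof
    fix k assume k: "k \<in> circulations D (insert e A) q"
    \<comment> \<open>This sign is 1 or -1, because exactly one end of \<open>e\<close> lies in
      \<open>C\<close>.\<close>
    let ?s = "of_bool (head D e \<in> C) - of_bool (tail D e \<in> C) :: int"
    have "int q dvd (\<Sum>v\<in>C. net_flow D (\<lambda>x. int (k x)) v)"
      using k assms(4) by (intro dvd_sum) (auto simp: circulations_def)
    also have "(\<Sum>v\<in>C. net_flow D (\<lambda>x. int (k x)) v)
        = (\<Sum>x\<in>arcs D. int (k x) * (of_bool (head D x \<in> C) - of_bool (tail D x \<in> C)))"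
      by (rule sum_net_flow[OF assms(3)])
    also have "\<dots> = (\<Sum>x\<in>arcs D. if x = e then int (k e) * ?s else 0)"
    proof (rule sum.cong)
      fix x assume x: "x \<in> arcs D"
      then have "k x = 0" if "x \<noteq> e" "x \<notin> A"
        using that k by (auto simp: circulations_def)
      then show "int (k x) * (of_bool (head D x \<in> C) - of_bool (tail D x \<in> C))
          = (if x = e then int (k e) * ?s else 0)"
        using assms(6)[of x] x by (cases "x \<in> A") auto
    qed simp
    also have "\<dots> = int (k e) * ?s"
      using assms(1,2) by simp
    finally have "int q dvd int (k e)"
      using assms(5) by (auto split: if_splits)
    moreover have "k e < q"
      using k assms(2) by (auto simp: circulations_def)
    ultimately have "k e = 0"
      by (auto dest: nat_dvd_not_less)
    then show "k \<in> circulations D A q"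
      using k by (auto simp: circulations_def)
  qed
qed

text \<open>Moebius inversion on the subset lattice: circulations confined to \<open>A\<close> are
  partitioned by their exact support, and nowhere-zero flows are those whose exact support is
  \<open>arcs D\<close>.\<close>

lemma card_nowhere_zero_flows:
  fixes D :: "('v, 'e) pre_digraph"
  assumes "finite (arcs D)"
  shows "int (card (nowhere_zero_flows D q))
    = (\<Sum>A\<in>Pow (arcs D). (-1) ^ (card (arcs D) - card A) * int (card (circulations D A q)))"
proof -
  define supp where "supp k = {e \<in> arcs D. k e \<noteq> 0}" for k :: "'e \<Rightarrow> nat"
  let ?K = "circulations D (arcs D) q"
  have fin: "finite ?K"
    by (rule finite_circulations[OF assms])
  have supp_iff: "supp k \<subseteq> A \<longleftrightarrow> (\<forall>e\<in>arcs D - A. k e = 0)" for k A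
    unfolding supp_def subset_iff mem_Collect_eq Ball_def Diff_iff by metis
  have circ: "circulations D A q = {k \<in> ?K. supp k \<subseteq> A}" for A
    unfolding circulations_def supp_iff by blast
  have "int (card (circulations D A q)) = (\<Sum>T\<in>Pow A. int (card {k \<in> ?K. supp k = T}))"
    if "finite A" for A
  proof -
    have "circulations D A q = (\<Union>T\<in>Pow A. {k \<in> ?K. supp k = T})"
      unfolding circ[of A] by blast
    also have "card \<dots> = (\<Sum>T\<in>Pow A. card {k \<in> ?K. supp k = T})"
      using fin that by (intro card_UN_disjoint) auto
    finally show ?thesis by simp
  qed
  from inclusion_exclusion_mobius[of "\<lambda>A. int (card (circulations D A q))", OF this assms]
  show ?thesis
    by (simp add: nowhere_zero_flows_eq[OF assms] supp_def)
qed

section \<open>Cycle rank and flow polynomial\<close>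

definition adjacency :: "('v, 'e) ugraph \<Rightarrow> 'e set \<Rightarrow> ('v \<times> 'v) set" where
  "adjacency G A = {(u, v). \<exists>e\<in>A. ends G e = {u, v}}"

text \<open>Defining the rank by counting avoids any reference to components or bases. Taking
  \<open>q = 2\<close> pins the exponent down once an orientation exists; that a single exponent
  serves all \<open>D\<close> and \<open>q\<close> is \<open>exists_cycle_rank\<close>.\<close>

definition cycle_rank :: "('v, 'e) ugraph \<Rightarrow> 'e set \<Rightarrow> nat" where
  "cycle_rank G A =
     (SOME m. \<forall>D q. orientation_of D G \<longrightarrow> q > 0 \<longrightarrow> card (circulations D A q) = q ^ m)"

lemma sym_adjacency: "sym (adjacency G A)"
  by (auto simp: sym_def adjacency_def insert_commute)

lemma orientation_ends:
  assumes "orientation_of D G" "e \<in> edges G" "ends G e = {u, v}"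
  shows "head D e = v \<and> tail D e = u \<or> head D e = u \<and> tail D e = v"
  using assms by (auto simp: orientation_of_def doubleton_eq_iff)

locale finite_ugraph =
  fixes G :: "('v, 'e) ugraph"
  assumes finite_vertices: "finite (vertices G)"
    and finite_edges: "finite (edges G)"
    and ends_edge: "e \<in> edges G \<Longrightarrow> \<exists>u v. u \<in> vertices G \<and> v \<in> vertices G \<and> ends G e = {u, v}"
begin

lemma exists_orientation: "\<exists>D. orientation_of D G"
proof -
  have "\<forall>e\<in>edges G. \<exists>p. {fst p, snd p} = ends G e"
    using ends_edge by (metis fst_conv snd_conv)
  then obtain f where "\<forall>e\<in>edges G. {fst (f e), snd (f e)} = ends G e"
    by metis
  then have "orientation_of
      \<lparr>verts = vertices G, arcs = edges G, tail = fst \<circ> f, head = snd \<circ> f\<rparr> G"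
    by (simp add: orientation_of_def)
  then show ?thesis ..
qed

text \<open>One unit is sent along a walk from \<open>u\<close> to \<open>w\<close>. An edge walked
  several times collects the sum of its contributions, so walks need not be reduced to simple
  paths.\<close>

lemma walk_flow:
  assumes "orientation_of D G" "A \<subseteq> edges G" "(u, w) \<in> (adjacency G A)\<^sup>*"
  shows "\<exists>h. (\<forall>x. x \<notin> A \<longrightarrow> h x = 0) \<and>
           (\<forall>v. net_flow D h v = of_bool (w = v) - of_bool (u = v))"
  using assms(3)
proof (induction rule: rtrancl_induct)
  case base
  have "net_flow D (\<lambda>x. 0) v = 0" for v
    by (simp add: net_flow_def)
  then show ?case by (intro exI[of _ "\<lambda>x. 0"]) simp
next
  case (step y z)
  from step.IH obtain h where h: "\<And>x. x \<notin> A \<Longrightarrow> h x = 0"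
    "\<And>v. net_flow D h v = of_bool (y = v) - of_bool (u = v)" by metis
  from step(2) obtain e where e: "e \<in> A" "ends G e = {y, z}"
    by (auto simp: adjacency_def)
  have D: "finite (arcs D)" "e \<in> arcs D"
    using assms(1,2) e(1) finite_edges by (auto simp: orientation_of_def)
  have ends: "head D e = z \<and> tail D e = y \<or> head D e = y \<and> tail D e = z"
    using orientation_ends[OF assms(1) _ e(2)] assms(2) e(1) by blast
  \<comment> \<open>The sign records whether \<open>e\<close> is traversed along or against its
    orientation; if \<open>y = z\<close>, both sides of the next fact vanish.\<close>
  define s :: int where "s = (if head D e = z then 1 else -1)"
  have s: "s * (of_bool (head D e = v) - of_bool (tail D e = v)) = of_bool (z = v) - of_bool (y = v)" for v
    using ends by (cases "head D e = z") (auto simp: s_def)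
  let ?h = "\<lambda>x. h x + (if x = e then s else 0)"
  have "net_flow D ?h v = of_bool (z = v) - of_bool (u = v)" for v
    unfolding net_flow_add net_flow_single[OF D] h(2) s by simp
  moreover have "?h x = 0" if "x \<notin> A" for x
    using h(1)[OF that] e(1) that by auto
  ultimately show ?case by (intro exI[of _ ?h]) simp
qed

text \<open>If \<open>A\<close> already connects the ends of \<open>e\<close>, a return walk closes
  \<open>e\<close> to a cycle, and the value on \<open>e\<close> is free. Otherwise the component of
  \<open>u\<close> gives a cut crossed by \<open>e\<close> alone, which forces the value
  zero.\<close>

lemma card_circulations_insert:
  assumes "orientation_of D G" "q > 0" "insert e A \<subseteq> edges G" "e \<notin> A" "ends G e = {u, w}"
  shows "card (circulations D (insert e A) q)
           = (if (u, w) \<in> (adjacency G A)\<^sup>* then q else 1) * card (circulations D A q)"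
proof -
  have D: "verts D = vertices G" "arcs D = edges G" "finite (arcs D)" "e \<in> arcs D"
    using assms(1,3) finite_edges by (auto simp: orientation_of_def)
  note ends = orientation_ends[OF assms(1) _ assms(5)]
  show ?thesis
  proof (cases "(u, w) \<in> (adjacency G A)\<^sup>*")
    case True
    then have "(head D e, tail D e) \<in> (adjacency G A)\<^sup>*"
      using ends assms(3) sym_rtrancl[OF sym_adjacency, of G A] by (auto dest: symD)
    from walk_flow[OF assms(1) _ this] assms(3)
    obtain h where h: "\<And>x. x \<notin> A \<Longrightarrow> h x = 0"
      "\<And>v. net_flow D h v = of_bool (tail D e = v) - of_bool (head D e = v)" by auto
    \<comment> \<open>The walk flow from head back to tail, completed by one unit on
      \<open>e\<close>. As \<open>e\<close> is not in \<open>A\<close>, the value at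
      \<open>e\<close> is exactly 1.\<close>
    let ?h = "\<lambda>x. h x + (if x = e then 1 else 0)"
    have "card (circulations D (insert e A) q) = q * card (circulations D A q)"
    proof (rule card_circulations_cycle[where h = ?h])
      show "net_flow D ?h v = 0" for v
        unfolding net_flow_add net_flow_single[OF D(3,4)] h(2) by simp
    qed (use D assms(2,4) h(1) in auto)
    with True show ?thesis by simp
  next
    case False
    let ?C = "{v \<in> vertices G. (u, v) \<in> (adjacency G A)\<^sup>*}"
    have uw: "u \<in> vertices G" "w \<in> vertices G"
      using ends_edge[of e] assms(3,5) by (auto simp: doubleton_eq_iff)
    have closed: "(u, y) \<in> (adjacency G A)\<^sup>* \<Longrightarrow> (u, z) \<in> (adjacency G A)\<^sup>*"
      if "x \<in> A" "ends G x = {y, z}" for x y z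
      using that by (auto simp: adjacency_def intro: rtrancl_into_rtrancl)
    have "circulations D (insert e A) q = circulations D A q"
    proof (rule circulations_cut[where C = ?C])
      show "(head D e \<in> ?C) \<noteq> (tail D e \<in> ?C)"
        using ends assms(3) False uw by auto
    next
      fix x assume x: "x \<in> A" "x \<in> arcs D"
      have "ends G x = {tail D x, head D x}" "ends G x = {head D x, tail D x}"
        using x(2) assms(1) by (auto simp: orientation_of_def)
      moreover have "ends G x \<subseteq> vertices G"
        using ends_edge[of x] x(2) D(2) by auto
      then have "head D x \<in> vertices G" "tail D x \<in> vertices G"
        unfolding \<open>ends G x = {tail D x, head D x}\<close> by simp_all
      ultimately show "(head D x \<in> ?C) = (tail D x \<in> ?C)"
        using closed[OF x(1)] by blast
    qed (use D finite_vertices in auto)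
    with False show ?thesis by simp
  qed
qed

text \<open>Edges are added one by one. Whether the exponent grows depends only on connectivity in
  \<open>A\<close>, hence neither on \<open>D\<close> nor on \<open>q\<close>.\<close>

lemma exists_cycle_rank:
  assumes "A \<subseteq> edges G"
  shows "\<exists>m. \<forall>D q. orientation_of D G \<longrightarrow> q > 0 \<longrightarrow> card (circulations D A q) = q ^ m"
proof -
  have "finite A" using assms finite_edges by (rule finite_subset)
  then show ?thesis
    using assms
  proof (induction A rule: finite_induct)
    case empty
    show ?case by (auto simp: circulations_empty intro!: exI[of _ 0])
  next
    case (insert e A)
    then obtain m where m: "\<And>D q. orientation_of D G \<Longrightarrow> q > 0 \<Longrightarrow> card (circulations D A q) = q ^ m"
      by auto
    obtain u w where e: "ends G e = {u, w}"
      using ends_edge insert.prems by blast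
    show ?case
      using card_circulations_insert[OF _ _ insert.prems insert.hyps(2) e] m
      by (intro exI[of _ "if (u, w) \<in> (adjacency G A)\<^sup>* then Suc m else m"]) auto
  qed
qed

section \<open>Computing with the cycle rank, mostly by comparing counts at
  \<open>q = 2\<close>\<close>

lemma card_circulations:
  assumes "A \<subseteq> edges G" "orientation_of D G" "q > 0"
  shows "card (circulations D A q) = q ^ cycle_rank G A"
  using someI_ex[OF exists_cycle_rank[OF assms(1)], folded cycle_rank_def] assms(2,3) by simp

lemma cycle_rank_empty: "cycle_rank G {} = 0"
proof -
  obtain D where "orientation_of D G" using exists_orientation ..
  then have "2 ^ cycle_rank G {} = card (circulations D {} 2)"
    by (intro card_circulations[symmetric]) auto
  also have "\<dots> = 1"
    by (simp add: circulations_empty)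
  finally show ?thesis by simp
qed

lemma cycle_rank_insert:
  assumes "insert e A \<subseteq> edges G" "e \<notin> A" "ends G e = {u, w}"
  shows "cycle_rank G (insert e A)
           = (if (u, w) \<in> (adjacency G A)\<^sup>* then Suc (cycle_rank G A) else cycle_rank G A)"
proof -
  obtain D where D: "orientation_of D G" using exists_orientation ..
  have "(2::nat) ^ cycle_rank G (insert e A)
          = (if (u, w) \<in> (adjacency G A)\<^sup>* then 2 else 1) * 2 ^ cycle_rank G A"
    using card_circulations_insert[OF D _ assms, of 2] assms(1)
    by (simp add: card_circulations[OF _ D] del: power_inject_exp)
  also have "\<dots> = 2 ^ (if (u, w) \<in> (adjacency G A)\<^sup>* then Suc (cycle_rank G A) else cycle_rank G A)"
    by simp
  finally show ?thesis
    by (subst (asm) power_inject_exp) simp_all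
qed

lemma cycle_rank_mono:
  assumes "A \<subseteq> B" "B \<subseteq> edges G"
  shows "cycle_rank G A \<le> cycle_rank G B"
proof -
  obtain D where D: "orientation_of D G" using exists_orientation ..
  then have "finite (arcs D)" using finite_edges by (simp add: orientation_of_def)
  then have "card (circulations D A 2) \<le> card (circulations D B 2)"
    using assms(1) by (intro card_mono finite_circulations circulations_mono)
  then show ?thesis
    using assms D by (simp add: card_circulations)
qed

text \<open>The alternating sum of circulation counts is polynomial in \<open>q\<close> by
  \<open>card_circulations\<close>. Uniqueness for \<open>THE\<close> holds because two candidates
  agree at all positive integers, which are infinitely many.\<close>

lemma flow_polynomial_eq:
  "flow_polynomial G
     = (\<Sum>A\<in>Pow (edges G). monom ((-1) ^ (card (edges G) - card A)) (cycle_rank G A))"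
    (is "_ = ?p")
  unfolding flow_polynomial_def
proof (rule the_equality)
  have "poly ?p (int q) = int (card (nowhere_zero_flows D q))"
    if "orientation_of D G" "q > 0" for D q
  proof -
    have "arcs D = edges G" using that(1) by (simp add: orientation_of_def)
    then show ?thesis
      using that finite_edges
      by (auto simp: card_nowhere_zero_flows poly_sum poly_monom card_circulations intro!: sum.cong)
  qed
  then show p: "\<forall>D. orientation_of D G \<longrightarrow>
      (\<forall>q>0. poly ?p (int q) = int (card (nowhere_zero_flows D q)))" by blast
  fix p'
  assume p': "\<forall>D. orientation_of D G \<longrightarrow>
      (\<forall>q>0. poly p' (int q) = int (card (nowhere_zero_flows D q)))"
  obtain D where "orientation_of D G" using exists_orientation ..
  then have "int ` {0<..} \<subseteq> {x. poly (p' - ?p) x = 0}"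
    using p p' by auto
  moreover have "infinite (int ` {0<..})"
    by (simp add: finite_image_iff infinite_Ioi)
  ultimately have "infinite {x. poly (p' - ?p) x = 0}"
    using finite_subset by blast
  then show "p' = ?p"
    using poly_roots_finite[of "p' - ?p"] by auto
qed

end

section \<open>Complete graphs\<close>

lemma finite_ugraph_complete:
  assumes "finite V"
  shows "finite_ugraph (complete_ugraph V)"
proof
  show "finite (edges (complete_ugraph V))"
    by (rule finite_subset[of _ "Pow V"]) (use assms in \<open>auto simp: complete_ugraph_def\<close>)
qed (use assms in \<open>auto simp: complete_ugraph_def card_2_iff\<close>)

lemma edge_complete_ugraph:
  "{u, v} \<in> edges (complete_ugraph V) \<longleftrightarrow> u \<in> V \<and> v \<in> V \<and> u \<noteq> v"
  by (auto simp: complete_ugraph_def card_2_iff doubleton_eq_iff)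

lemma ends_complete_ugraph: "ends (complete_ugraph V) e = e"
  by (simp add: complete_ugraph_def)

lemma path2_complete_ugraph:
  assumes "{u, w} \<in> A" "{w, v} \<in> A"
  shows "(u, v) \<in> (adjacency (complete_ugraph V) A)\<^sup>*"
proof -
  have "(u, w) \<in> adjacency (complete_ugraph V) A" "(w, v) \<in> adjacency (complete_ugraph V) A"
    using assms by (auto simp: adjacency_def ends_complete_ugraph)
  then show ?thesis by (meson r_into_rtrancl rtrancl_into_rtrancl)
qed

lemma card_edges_complete_ugraph:
  "finite V \<Longrightarrow> card (edges (complete_ugraph V)) = card V choose 2"
  by (simp add: complete_ugraph_def n_subsets)

text \<open>Each new leaf is isolated in the star built so far, so its edge closes no cycle.\<close>

lemma cycle_rank_star:
  assumes "finite V" "c \<in> V" "W \<subseteq> V - {c}"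
  shows "cycle_rank (complete_ugraph V) ((\<lambda>w. {c, w}) ` W) = 0"
proof -
  interpret finite_ugraph "complete_ugraph V"
    by (rule finite_ugraph_complete[OF assms(1)])
  have "finite W" using assms finite_subset by blast
  then show ?thesis
    using assms(3)
  proof (induction W rule: finite_induct)
    case empty
    show ?case by (simp add: cycle_rank_empty)
  next
    case (insert v W)
    let ?A = "(\<lambda>w. {c, w}) ` W"
    have "(c, v) \<notin> (adjacency (complete_ugraph V) ?A)\<^sup>*"
    proof
      assume "(c, v) \<in> (adjacency (complete_ugraph V) ?A)\<^sup>*"
      then show False
        using insert.prems insert.hyps(2)
        \<comment> \<open>Splitting off the last step of the walk: either \<open>c = v\<close>, or
          some edge of \<open>?A\<close> contains \<open>v\<close>. Both are excluded.\<close>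
        by (cases rule: rtranclE)
          (auto simp: adjacency_def ends_complete_ugraph doubleton_eq_iff)
    qed
    moreover have "insert {c, v} ?A \<subseteq> edges (complete_ugraph V)"
      using insert.prems assms(2) by (auto simp: edge_complete_ugraph)
    moreover have "{c, v} \<notin> ?A"
      using insert.hyps(2) insert.prems by (auto simp: doubleton_eq_iff)
    ultimately show ?case
      using insert by (simp add: cycle_rank_insert[of _ _ c v] ends_complete_ugraph)
  qed
qed

text \<open>Start from a spanning star with centre \<open>c\<close>, of rank zero. Each further edge
  closes a triangle through \<open>c\<close> and so adds one to the rank; the star accounts for
  \<open>card V - 1\<close> edges.\<close>

lemma cycle_rank_complete_ugraph:
  assumes "finite V" "V \<noteq> {}"
  shows "cycle_rank (complete_ugraph V) (edges (complete_ugraph V)) + (card V - 1) = card V choose 2"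
proof -
  interpret finite_ugraph "complete_ugraph V"
    by (rule finite_ugraph_complete[OF assms(1)])
  let ?G = "complete_ugraph V"
  obtain c where c: "c \<in> V" using assms(2) by blast
  let ?S = "(\<lambda>w. {c, w}) ` (V - {c})"
  have S: "?S \<subseteq> edges ?G" using c by (auto simp: edge_complete_ugraph)
  have rank: "cycle_rank ?G (X \<union> ?S) = card X" if "finite X" "X \<subseteq> edges ?G - ?S" for X
    using that
  proof (induction X rule: finite_induct)
    case empty
    show ?case using cycle_rank_star[OF assms(1) c order.refl] by simp
  next
    case (insert e X)
    obtain u v where e: "e = {u, v}" "u \<in> V" "v \<in> V"
      using ends_edge[of e] insert.prems by (auto simp: ends_complete_ugraph complete_ugraph_def)
    have "u \<noteq> c" "v \<noteq> c"
      using insert.prems e by (auto simp: edge_complete_ugraph insert_commute)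
    then have "{u, c} \<in> X \<union> ?S" "{c, v} \<in> X \<union> ?S"
      using e by (auto simp: insert_commute)
    then have "(u, v) \<in> (adjacency ?G (X \<union> ?S))\<^sup>*"
      by (rule path2_complete_ugraph)
    moreover have "insert e (X \<union> ?S) \<subseteq> edges ?G" "e \<notin> X \<union> ?S"
      using insert.prems insert.hyps(2) S by auto
    ultimately have "cycle_rank ?G (insert e (X \<union> ?S)) = Suc (cycle_rank ?G (X \<union> ?S))"
      using cycle_rank_insert[of e "X \<union> ?S" u v] e(1) by (simp add: ends_complete_ugraph)
    then show ?case
      using insert by simp
  qed
  have "inj_on (\<lambda>w. {c, w}) (V - {c})"
    by (auto simp: inj_on_def doubleton_eq_iff)
  then have "card ?S = card V - 1"
    using c assms(1) by (simp add: card_image)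
  moreover have "card (edges ?G) = card (edges ?G - ?S) + card ?S"
    using S finite_edges by (simp add: card_Diff_subset card_mono finite_subset)
  moreover have "edges ?G - ?S \<union> ?S = edges ?G" using S by auto
  then have "cycle_rank ?G (edges ?G) = card (edges ?G - ?S)"
    using rank[of "edges ?G - ?S"] finite_edges by simp
  ultimately show ?thesis
    using card_edges_complete_ugraph[OF assms(1)] by simp
qed

text \<open>The \<open>card V - 2\<close> paths of length two from \<open>u\<close> to
  \<open>v\<close> are pairwise edge-disjoint, so fewer deleted edges than that cannot destroy all
  of them.\<close>

lemma surviving_path2:
  assumes "finite V" "u \<in> V" "v \<in> V" "u \<noteq> v" "finite B" "card B + 2 < card V"
  obtains w where "w \<in> V - {u, v}" "{u, w} \<notin> B" "{w, v} \<notin> B"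
proof (rule ccontr)
  assume "\<not> thesis"
  then have B: "{u, w} \<in> B \<or> {w, v} \<in> B" if "w \<in> V - {u, v}" for w
    using that \<open>\<And>w. w \<in> V - {u, v} \<Longrightarrow> {u, w} \<notin> B \<Longrightarrow> {w, v} \<notin> B \<Longrightarrow> thesis\<close> by blast
  \<comment> \<open>A deleted edge on the path through \<open>w\<close>; edges chosen for different
    \<open>w\<close> differ, since \<open>w\<close> is their only end outside \<open>u\<close> and
    \<open>v\<close>.\<close>
  let ?f = "\<lambda>w. if {u, w} \<in> B then {u, w} else {w, v}"
  have "inj_on ?f (V - {u, v})"
    by (auto simp: inj_on_def doubleton_eq_iff split: if_splits)
  moreover have "?f ` (V - {u, v}) \<subseteq> B" using B by auto
  ultimately have "card (V - {u, v}) \<le> card B"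
    using assms(5) card_inj_on_le by blast
  then show False
    using assms by (simp add: card_Diff_subset)
qed

text \<open>When \<open>e\<close> is deleted after \<open>B\<close>, a path of length two still
  joins its ends, so the rank drops by exactly one. Counting \<open>e\<close> itself in the bound
  supplies the strict inequality that \<open>surviving_path2\<close> asks for.\<close>

lemma cycle_rank_complete_ugraph_Diff:
  assumes "finite V" "B \<subseteq> edges (complete_ugraph V)" "card B + 2 \<le> card V"
  shows "cycle_rank (complete_ugraph V) (edges (complete_ugraph V) - B) + card B
           = cycle_rank (complete_ugraph V) (edges (complete_ugraph V))"
proof -
  interpret finite_ugraph "complete_ugraph V"
    by (rule finite_ugraph_complete[OF assms(1)])
  let ?G = "complete_ugraph V"
  have "finite B" using assms(2) finite_edges finite_subset by blast
  then show ?thesis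
    using assms(2,3)
  proof (induction B rule: finite_induct)
    case empty
    show ?case by simp
  next
    case (insert e B)
    let ?A = "edges ?G - insert e B"
    obtain u v where "e = {u, v}"
      using ends_edge[of e] insert.prems by (auto simp: ends_complete_ugraph)
    then have e: "e = {u, v}" "u \<in> V" "v \<in> V" "u \<noteq> v"
      using insert.prems by (auto simp: edge_complete_ugraph)
    obtain w where w: "w \<in> V - {u, v}" "{u, w} \<notin> B" "{w, v} \<notin> B"
      using surviving_path2[OF assms(1) e(2-4) insert.hyps(1)] insert by auto
    then have "{u, w} \<in> ?A" "{w, v} \<in> ?A"
      using e by (auto simp: edge_complete_ugraph doubleton_eq_iff)
    then have "(u, v) \<in> (adjacency ?G ?A)\<^sup>*"
      by (rule path2_complete_ugraph)
    then have "cycle_rank ?G (insert e ?A) = Suc (cycle_rank ?G ?A)"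
      using insert.prems e(1) by (subst cycle_rank_insert[of e ?A u v]) (auto simp: ends_complete_ugraph)
    moreover have "insert e ?A = edges ?G - B"
      using insert by auto
    ultimately show ?case using insert by simp
  qed
qed

section \<open>The leading coefficients for complete graphs\<close>

theorem corollary2:
  fixes V :: "'v set" and n N N' :: nat
  assumes "n > 2"
    and "finite V" and "card V = n"
    and "N = n * (n - 1) div 2" and "N' = (n - 1) * (n - 2) div 2"
  shows "degree (flow_polynomial (complete_ugraph V)) = N' \<and>
    (\<forall>k\<le>n - 3. coeff (flow_polynomial (complete_ugraph V)) (N' - k) = (-1) ^ k * int (N choose k))"
proof -
  interpret finite_ugraph "complete_ugraph V"
    by (rule finite_ugraph_complete[OF assms(2)])
  let ?G = "complete_ugraph V"
  let ?E = "edges ?G"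
  let ?r = "cycle_rank ?G"
  have cardE: "card ?E = N"
    using assms by (simp add: card_edges_complete_ugraph choose_two)
  obtain j where j: "n = j + 3" using assms(1) le_Suc_ex[of 3 n] by auto
  have N: "N = N' + (n - 1)"
  proof -
    have "n * (n - 1) = (n - 1) * (n - 2) + (n - 1) * 2"
      by (simp add: j algebra_simps)
    then show ?thesis using assms(4,5) by simp
  qed
  \<comment> \<open>This keeps the truncated differences \<open>N' - k\<close> genuine in the range
    considered.\<close>
  have N'_ge: "n - 2 \<le> N'"
  proof -
    have "2 * (n - 2) \<le> (n - 1) * (n - 2)"
      using assms(1) by (intro mult_right_mono) auto
    then show ?thesis using assms(5) by linarith
  qed
  have rE: "?r ?E = N'"
    using cycle_rank_complete_ugraph[OF assms(2)] card_edges_complete_ugraph[OF assms(2)]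
      cardE N assms(1,3) by force
  have rank_le: "?r A \<le> N'" if "A \<subseteq> ?E" for A
    using cycle_rank_mono[OF that order.refl] rE by simp
  \<comment> \<open>Subsets contributing to the coefficient of degree \<open>N' - k\<close> are thus
    exactly the complements of \<open>k\<close>-edge sets.\<close>
  have rank_iff: "?r A = N' - k \<longleftrightarrow> card A = N - k" if A: "A \<subseteq> ?E" and k: "k \<le> n - 3" for A k
  proof -
    have fin: "finite (?E - A)" using finite_edges by simp
    have cA: "card A + card (?E - A) = N"
      using card_Un_disjoint[of A "?E - A"] A fin finite_subset[OF A finite_edges] cardE
      by (simp add: Un_absorb1)
    show ?thesis
    proof (cases "card (?E - A) \<le> n - 2")
      case True
      have "?E - (?E - A) = A" using A by auto
      then have "?r A + card (?E - A) = N'"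
        using cycle_rank_complete_ugraph_Diff[OF assms(2), of "?E - A"] True assms(1,3) rE by simp
      then show ?thesis using cA k N N'_ge assms(1) by linarith
    next
      \<comment> \<open>Both sides are false here: at least \<open>n - 1 > k\<close> edges are
        missing, and deleting only \<open>n - 2\<close> of them already pushes the rank down to
        \<open>N' - (n - 2)\<close>, below \<open>N' - k\<close>.\<close>
      case False
      then obtain B where B: "B \<subseteq> ?E - A" "card B = n - 2"
        using obtain_subset_with_card_n[of "n - 2" "?E - A"] by auto
      have "?r A \<le> ?r (?E - B)"
        using A B(1) by (intro cycle_rank_mono) auto
      moreover have "?r (?E - B) + (n - 2) = N'"
        using cycle_rank_complete_ugraph_Diff[OF assms(2) order.trans[OF B(1) Diff_subset]]
          B(2) assms(1,3) rE by simp
      ultimately show ?thesis using cA k N N'_ge assms(1) False by linarith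
    qed
  qed
  have coeff: "coeff (flow_polynomial ?G) (N' - k) = (-1) ^ k * int (N choose k)"
    if k: "k \<le> n - 3" for k
  proof -
    have kN: "k \<le> N" using k N by simp
    \<comment> \<open>All contributing subsets carry the same sign, because
      \<open>N - card A = k\<close>.\<close>
    have "coeff (flow_polynomial ?G) (N' - k)
            = (\<Sum>A\<in>Pow ?E. if card A = N - k then (-1) ^ k else 0)"
      unfolding flow_polynomial_eq coeff_sum coeff_monom
      using rank_iff[OF _ k] kN cardE by (intro sum.cong) auto
    also have "\<dots> = (-1) ^ k * int (card {A. A \<subseteq> ?E \<and> card A = N - k})"
      using finite_edges by (simp flip: sum.inter_filter)
    also have "card {A. A \<subseteq> ?E \<and> card A = N - k} = N choose k"
      using finite_edges binomial_symmetric[OF kN] by (simp add: n_subsets cardE)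
    finally show ?thesis .
  qed
  have "degree (flow_polynomial ?G) \<le> N'"
    unfolding flow_polynomial_eq using finite_edges rank_le
    by (intro degree_sum_le) (auto intro: order.trans[OF degree_monom_le])
  \<comment> \<open>The case \<open>k = 0\<close> gives coefficient 1 at \<open>N'\<close>, which is
    nonzero.\<close>
  moreover have "N' \<le> degree (flow_polynomial ?G)"
    using coeff[of 0] by (intro le_degree) simp
  ultimately show ?thesis using coeff by simp
qed

end
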